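(* Let $S>0$ and let $b$ be a locally finite connected graph over $(X,m)$. (i) Define, for all $x,y\in X$, $$\rho_S'(x,y)=\sup\{\rho(x,y): \rho\text{ is an intrinsic pseudo-metric with finite balls and jump size bounded by }S\}.$$ Then $\sqrt2\,\rho_S'\le\rho_{\mathcal E}$ on $X\times X$. (ii) If $\sup_{x\in X}\mathrm{Deg}(x)<\infty$, then $\sqrt2\,\rho_S\le\rho_{\mathcal E}$ on $X\times X$. (iii) If $b$ is $\sqrt2S$-regular, then $\sqrt2\,\rho_S\ge\rho_{\mathcal E}$ on $X\times X$.
   Context: **Graphs.** $X$ is a countable set, and $m\colon X\to(0,\infty)$. A graph over $(X,m)$ is a symmetric function $b\colon X\times X\to[0,\infty)$ with $b(x,x)=0$ and $\deg(x)=\sum_{y}b(x,y)<\infty$ for all $x$. Write $x\sim y$ if $b(x,y)>0$. The graph is locally finite if $\{y: y\sim x\}$ is finite for all $x$, and connected if any two vertices are joined by a finite path $x=x_0\sim\dots\sim x_k=y$. $\mathrm{Deg}(x)=\deg(x)/m(x)$. **Energy.** $\mathcal C_c(X)$ is the set of finitely supported real functions on $X$. $\mathcal E(f)=\frac12\sum_{x,y}b(x,y)(f(x)-f(y))^2$, with domain $\mathcal D(\mathcal E)\subset\ell^2(X,m)$ the form domain of the Friedrichs extension of $\Delta f(x)=\frac1{m(x)}\sum_y b(x,y)(f(x)-f(y))$ on $\mathcal C_c(X)$; in particular $\mathcal C_c(X)\subset\mathcal D(\mathcal E)$. For $f\colon X\to\mathbb R$, $\Gamma(f)(x)=\frac1{2m(x)}\sum_{y\in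 X}b(x,y)(f(x)-f(y))^2$. **Davies' metric.** $\rho_{\mathcal E}(x,y)=\sup\{|\psi(x)-\psi(y)|:\psi\in\mathcal C_c(X)\cap\mathcal D(\mathcal E),\ \|\Gamma(\psi)\|_\infty\le1\}$. **Regularity.** For $K>0$, $b$ is $K$-regular if $|\psi(x)-\psi(y)|\le K$ for all $x,y$ with $b(x,y)>0$ and all $\psi\in\mathcal C_c(X)\cap\mathcal D(\mathcal E)$ with $\|\Gamma(\psi)\|_\infty\le1$. **Intrinsic metrics.** A pseudo-metric $\rho\colon X\times X\to[0,\infty)$ is intrinsic if $\sum_y b(x,y)\rho(x,y)^2\le m(x)$ for all $x\in X$. Its jump size is $\sup\{\rho(x,y): b(x,y)>0\}$. It has finite balls if $\{y:\rho(x,y)\le R\}$ is finite for all $x\in X$, $R\ge0$. Define $$\rho_S(x,y)=\sup\{\rho(x,y):\rho\text{ is an intrinsic pseudo-metric with jump size bounded by }S\}.$$ The supremum of the empty set of nonnegative numbers is taken to be $0$. *)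

theory Defs
  imports "HOL-Analysis.Analysis"
begin

text \<open>
  The vertex set is the universe of a countable type. Sums of nonnegative terms and suprema of
  nonnegative numbers are taken in \<^typ>\<open>ennreal\<close>, where they always exist (possibly \<open>\<infinity>\<close>) and
  where the supremum of the empty set is \<open>0\<close>.
\<close>

definition deg :: "('a \<Rightarrow> 'a \<Rightarrow> real) \<Rightarrow> 'a \<Rightarrow> ennreal" where
  "deg b x = (\<Sum>\<^sub>\<infinity>y. ennreal (b x y))"

definition weighted_graph :: "('a \<Rightarrow> 'a \<Rightarrow> real) \<Rightarrow> ('a \<Rightarrow> real) \<Rightarrow> bool" where
  "weighted_graph b m \<longleftrightarrow>
     (\<forall>x. 0 < m x) \<and>
     (\<forall>x y. 0 \<le> b x y) \<and> (\<forall>x y. b x y = b y x) \<and> (\<forall>x. b x x = 0) \<and>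
     (\<forall>x. deg b x < \<infinity>)"

definition adj :: "('a \<Rightarrow> 'a \<Rightarrow> real) \<Rightarrow> 'a \<Rightarrow> 'a \<Rightarrow> bool" where
  "adj b x y \<longleftrightarrow> 0 < b x y"

definition locally_finite_graph :: "('a \<Rightarrow> 'a \<Rightarrow> real) \<Rightarrow> bool" where
  "locally_finite_graph b \<longleftrightarrow> (\<forall>x. finite {y. adj b y x})"

definition connected_graph :: "('a \<Rightarrow> 'a \<Rightarrow> real) \<Rightarrow> bool" where
  "connected_graph b \<longleftrightarrow> (\<forall>x y. (adj b)\<^sup>*\<^sup>* x y)"

definition Deg :: "('a \<Rightarrow> 'a \<Rightarrow> real) \<Rightarrow> ('a \<Rightarrow> real) \<Rightarrow> 'a \<Rightarrow> ennreal" where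
  "Deg b m x = deg b x / ennreal (m x)"

definition Cc :: "('a \<Rightarrow> real) set" where
  "Cc = {f. finite {x. f x \<noteq> 0}}"

definition Laplacian :: "('a \<Rightarrow> 'a \<Rightarrow> real) \<Rightarrow> ('a \<Rightarrow> real) \<Rightarrow> ('a \<Rightarrow> real) \<Rightarrow> 'a \<Rightarrow> real" where
  "Laplacian b m f x = 1 / m x * (\<Sum>\<^sub>\<infinity>y. b x y * (f x - f y))"

definition energy :: "('a \<Rightarrow> 'a \<Rightarrow> real) \<Rightarrow> ('a \<Rightarrow> real) \<Rightarrow> ennreal" where
  "energy b f = (\<Sum>\<^sub>\<infinity>(x, y). ennreal (b x y * (f x - f y)\<^sup>2)) / 2"

definition l2 :: "('a \<Rightarrow> real) \<Rightarrow> ('a \<Rightarrow> real) set" where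
  "l2 m = {f. (\<lambda>x. m x * (f x)\<^sup>2) summable_on UNIV}"

definition l2_inner :: "('a \<Rightarrow> real) \<Rightarrow> ('a \<Rightarrow> real) \<Rightarrow> ('a \<Rightarrow> real) \<Rightarrow> real" where
  "l2_inner m f g = (\<Sum>\<^sub>\<infinity>x. m x * f x * g x)"

text \<open>
  For a nonnegative symmetric operator \<open>A\<close> with domain \<open>D\<close> in \<open>l2 m\<close>, the form domain of its
  Friedrichs extension is the domain of the closure of the form \<open>f \<mapsto> \<langle>A f, f\<rangle>\<close> on \<open>D\<close>.
\<close>

definition friedrichs_form_domain ::
    "('a \<Rightarrow> real) \<Rightarrow> (('a \<Rightarrow> real) \<Rightarrow> 'a \<Rightarrow> real) \<Rightarrow> ('a \<Rightarrow> real) set \<Rightarrow> ('a \<Rightarrow> real) set" where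
  "friedrichs_form_domain m A D =
     {f \<in> l2 m. \<exists>\<phi> :: nat \<Rightarrow> 'a \<Rightarrow> real.
        (\<forall>n. \<phi> n \<in> D) \<and>
        (\<lambda>n. l2_inner m (\<lambda>x. \<phi> n x - f x) (\<lambda>x. \<phi> n x - f x)) \<longlonglongrightarrow> 0 \<and>
        (\<forall>e>0. \<exists>N. \<forall>n\<ge>N. \<forall>k\<ge>N.
           l2_inner m (A (\<lambda>x. \<phi> n x - \<phi> k x)) (\<lambda>x. \<phi> n x - \<phi> k x) < e)}"

definition form_domain :: "('a \<Rightarrow> 'a \<Rightarrow> real) \<Rightarrow> ('a \<Rightarrow> real) \<Rightarrow> ('a \<Rightarrow> real) set" where
  "form_domain b m = friedrichs_form_domain m (Laplacian b m) Cc"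

definition Gamma :: "('a \<Rightarrow> 'a \<Rightarrow> real) \<Rightarrow> ('a \<Rightarrow> real) \<Rightarrow> ('a \<Rightarrow> real) \<Rightarrow> 'a \<Rightarrow> ennreal" where
  "Gamma b m f x = (\<Sum>\<^sub>\<infinity>y. ennreal (b x y * (f x - f y)\<^sup>2)) / ennreal (2 * m x)"

text \<open>
  As every vertex has positive measure, the essential supremum norm of \<^term>\<open>Gamma b m \<psi>\<close> is
  its supremum.
\<close>

definition davies_test :: "('a \<Rightarrow> 'a \<Rightarrow> real) \<Rightarrow> ('a \<Rightarrow> real) \<Rightarrow> ('a \<Rightarrow> real) set" where
  "davies_test b m = {\<psi> \<in> Cc \<inter> form_domain b m. (SUP x. Gamma b m \<psi> x) \<le> 1}"

definition rho_E :: "('a \<Rightarrow> 'a \<Rightarrow> real) \<Rightarrow> ('a \<Rightarrow> real) \<Rightarrow> 'a \<Rightarrow> 'a \<Rightarrow> ennreal" where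
  "rho_E b m x y = (SUP \<psi>\<in>davies_test b m. ennreal \<bar>\<psi> x - \<psi> y\<bar>)"

definition regular_graph :: "real \<Rightarrow> ('a \<Rightarrow> 'a \<Rightarrow> real) \<Rightarrow> ('a \<Rightarrow> real) \<Rightarrow> bool" where
  "regular_graph K b m \<longleftrightarrow>
     (\<forall>\<psi>\<in>davies_test b m. \<forall>x y. 0 < b x y \<longrightarrow> \<bar>\<psi> x - \<psi> y\<bar> \<le> K)"

definition pseudo_metric :: "('a \<Rightarrow> 'a \<Rightarrow> real) \<Rightarrow> bool" where
  "pseudo_metric \<rho> \<longleftrightarrow>
     (\<forall>x y. 0 \<le> \<rho> x y) \<and> (\<forall>x. \<rho> x x = 0) \<and> (\<forall>x y. \<rho> x y = \<rho> y x) \<and>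
     (\<forall>x y z. \<rho> x z \<le> \<rho> x y + \<rho> y z)"

definition intrinsic :: "('a \<Rightarrow> 'a \<Rightarrow> real) \<Rightarrow> ('a \<Rightarrow> real) \<Rightarrow> ('a \<Rightarrow> 'a \<Rightarrow> real) \<Rightarrow> bool" where
  "intrinsic b m \<rho> \<longleftrightarrow> (\<forall>x. (\<Sum>\<^sub>\<infinity>y. ennreal (b x y * (\<rho> x y)\<^sup>2)) \<le> ennreal (m x))"

definition jump_size :: "('a \<Rightarrow> 'a \<Rightarrow> real) \<Rightarrow> ('a \<Rightarrow> 'a \<Rightarrow> real) \<Rightarrow> ennreal" where
  "jump_size b \<rho> = (SUP (x, y)\<in>{(x, y). 0 < b x y}. ennreal (\<rho> x y))"

definition finite_balls :: "('a \<Rightarrow> 'a \<Rightarrow> real) \<Rightarrow> bool" where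
  "finite_balls \<rho> \<longleftrightarrow> (\<forall>x. \<forall>R\<ge>0. finite {y. \<rho> x y \<le> R})"

definition rho :: "real \<Rightarrow> ('a \<Rightarrow> 'a \<Rightarrow> real) \<Rightarrow> ('a \<Rightarrow> real) \<Rightarrow> 'a \<Rightarrow> 'a \<Rightarrow> ennreal" where
  "rho S b m x y =
     (SUP \<rho>\<in>{\<rho>. pseudo_metric \<rho> \<and> intrinsic b m \<rho> \<and> jump_size b \<rho> \<le> ennreal S}.
        ennreal (\<rho> x y))"

definition rho' :: "real \<Rightarrow> ('a \<Rightarrow> 'a \<Rightarrow> real) \<Rightarrow> ('a \<Rightarrow> real) \<Rightarrow> 'a \<Rightarrow> 'a \<Rightarrow> ennreal" where
  "rho' S b m x y =
     (SUP \<rho>\<in>{\<rho>. pseudo_metric \<rho> \<and> intrinsic b m \<rho> \<and> finite_balls \<rho> \<and>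
              jump_size b \<rho> \<le> ennreal S}.
        ennreal (\<rho> x y))"

lemma Cc_subset_form_domain: "Cc \<subseteq> form_domain b m"
proof
  fix f :: "'a \<Rightarrow> real" assume f: "f \<in> Cc"
  have 1: "f \<in> l2 m"
    using f unfolding l2_def Cc_def mem_Collect_eq
    by (intro summable_on_cong_neutral[THEN iffD1, OF _ _ _ summable_on_finite[of "{x. f x \<noteq> 0}"]]) auto
  have 0: "l2_inner m g (\<lambda>x. 0) = 0" for g by (simp add: l2_inner_def)
  show "f \<in> form_domain b m"
    unfolding form_domain_def friedrichs_form_domain_def mem_Collect_eq
    using f by (intro conjI 1 exI[of _ "\<lambda>_. f"]) (simp_all add: 0)
qed

lemma energy_eq_Laplacian_form:
  assumes G: "weighted_graph b m" and lf: "locally_finite_graph b" and f: "f \<in> Cc"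
  shows "energy b f = ennreal (l2_inner m (Laplacian b m f) f)"
proof -
  have m: "0 < m x" and b0: "0 \<le> b x y" and sym: "b x y = b y x" for x y
    using G unfolding weighted_graph_def by auto
  define F where "F = {x. f x \<noteq> 0}"
  define K where "K = F \<union> (\<Union>x\<in>F. {y. adj b y x})"
  have finF: "finite F" using f by (simp add: F_def Cc_def)
  have finK: "finite K"
    using finF lf by (auto simp: K_def locally_finite_graph_def)
  have adj_K: "y \<in> K" if "x \<in> F" "b x y \<noteq> 0" for x y
    using that b0[of y x] sym[of x y] by (auto simp: K_def adj_def less_le)
  have off: "b x y * (f x - f y)\<^sup>2 = 0" if "(x, y) \<notin> K \<times> K" for x y
  proof (cases "b x y = 0 \<or> f x = f y")
    case False
    then have "x \<in> F \<or> y \<in> F" by (auto simp: F_def)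
    then have "x \<in> K \<and> y \<in> K"
      using adj_K[of x y] adj_K[of y x] False sym[of x y] by (auto simp: K_def)
    with that show ?thesis by auto
  qed auto
  have "(\<Sum>\<^sub>\<infinity>(x, y). ennreal (b x y * (f x - f y)\<^sup>2))
      = (\<Sum>\<^sub>\<infinity>(x, y)\<in>K \<times> K. ennreal (b x y * (f x - f y)\<^sup>2))"
    by (rule infsum_cong_neutral) (auto split: prod.splits, (metis off ennreal_0 mem_Sigma_iff)+)
  also have "\<dots> = (\<Sum>(x, y)\<in>K \<times> K. ennreal (b x y * (f x - f y)\<^sup>2))"
    using finK by simp
  also have "\<dots> = ennreal (\<Sum>(x, y)\<in>K \<times> K. b x y * (f x - f y)\<^sup>2)"
    by (simp add: sum_ennreal b0 case_prod_beta)
  finally have E: "energy b f = ennreal ((\<Sum>x\<in>K. \<Sum>y\<in>K. b x y * (f x - f y)\<^sup>2) / 2)"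
    by (simp add: energy_def sum.cartesian_product sum_nonneg b0 case_prod_beta divide_ennreal
        flip: ennreal_numeral)
  have L: "m x * Laplacian b m f x * f x = (\<Sum>y\<in>K. b x y * (f x - f y) * f x)" for x
  proof (cases "x \<in> F")
    case True
    have "(\<Sum>\<^sub>\<infinity>y. b x y * (f x - f y)) = (\<Sum>\<^sub>\<infinity>y\<in>K. b x y * (f x - f y))"
      by (rule infsum_cong_neutral) (use adj_K[OF True] in auto)
    then show ?thesis
      using m[of x] finK by (simp add: Laplacian_def sum_distrib_right)
  qed (simp add: F_def)
  have "l2_inner m (Laplacian b m f) f = (\<Sum>\<^sub>\<infinity>x\<in>K. m x * Laplacian b m f x * f x)"
    unfolding l2_inner_def by (rule infsum_cong_neutral) (auto simp: K_def F_def)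
  also have "\<dots> = (\<Sum>x\<in>K. \<Sum>y\<in>K. b x y * (f x - f y) * f x)"
    using finK by (simp add: L)
  finally have l: "l2_inner m (Laplacian b m f) f = (\<Sum>x\<in>K. \<Sum>y\<in>K. b x y * (f x - f y) * f x)" .
  have swap: "(\<Sum>x\<in>K. \<Sum>y\<in>K. b x y * (f x - f y) * f x)
      = (\<Sum>x\<in>K. \<Sum>y\<in>K. b x y * (f y - f x) * f y)"
    by (subst sum.swap) (simp add: sym)
  have "(\<Sum>x\<in>K. \<Sum>y\<in>K. b x y * (f x - f y)\<^sup>2)
      = (\<Sum>x\<in>K. \<Sum>y\<in>K. b x y * (f x - f y) * f x) + (\<Sum>x\<in>K. \<Sum>y\<in>K. b x y * (f y - f x) * f y)"
    by (simp add: sum.distrib[symmetric] power2_eq_square algebra_simps)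
  with swap l E show ?thesis by simp
qed

end

theory Submission
  imports Defs
begin

text \<open>
  All three comparisons rest on one dictionary: a finitely supported \<open>\<psi>\<close> is admissible in Davies'
  supremum exactly if the pseudo-metric \<open>|\<psi> x - \<psi> y| / \<surd>2\<close> is intrinsic
  (\<open>davies_test_iff_intrinsic\<close>); the two factors \<open>1/2\<close> in \<^const>\<open>Gamma\<close> and in the square of
  \<open>1/\<surd>2\<close> match.

  Part (iii) is immediate from this: \<open>\<surd>2 S\<close>-regularity says that this pseudo-metric has jump size at
  most \<open>S\<close>, so it competes in \<^const>\<open>rho\<close>.

  For part (i), an intrinsic \<open>\<rho>\<close> with finite balls yields for every \<open>x\<close> and \<open>r\<close> the tent function
  \<open>z \<mapsto> \<surd>2 max 0 (r - \<rho> x z)\<close>. It is \<open>\<surd>2\<close>-Lipschitz for \<open>\<rho>\<close>, hence admissible, and with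
  \<open>r = \<rho> x y\<close> it separates \<open>x\<close> and \<open>y\<close> by exactly \<open>\<surd>2 \<rho> x y\<close> (\<open>rho_E_ge_finite_balls\<close>).

  For part (ii), let \<open>D\<close> bound the weighted degree. The combinatorial distance divided by \<open>\<surd>D\<close> is then
  intrinsic, since along edges it equals \<open>1/\<surd>D\<close>, and its balls are finite because the graph is
  locally finite and connected. By convexity of the square, any convex combination of it with a given
  intrinsic \<open>\<rho>\<close> is again intrinsic; and it has finite balls as soon as the combinatorial distance gets
  a positive weight. So \<open>rho_E_ge_finite_balls\<close> applies to the combination, and letting this weight tend
  to \<open>0\<close> gives the estimate for \<open>\<rho>\<close> (\<open>rho_E_ge_bounded_Deg\<close>).
\<close>

section \<open>Intrinsic pseudo-metrics through finite sums\<close>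

text \<open>
  Multiplication on \<^typ>\<open>ennreal\<close> is not continuous at \<open>0 \<cdot> \<infinity>\<close>, so constants are awkward to move
  through infinite sums there. A nonnegative sum is the supremum of its finite
  partial sums, so every bound on it is a family of inequalities between finite real sums.
\<close>

lemma infsum_ennreal_le_iff:
  fixes f :: "'a \<Rightarrow> real"
  assumes "\<And>y. 0 \<le> f y" "0 \<le> c"
  shows "(\<Sum>\<^sub>\<infinity>y. ennreal (f y)) \<le> ennreal c \<longleftrightarrow> (\<forall>F. finite F \<longrightarrow> sum f F \<le> c)"
proof -
  have "(\<Sum>\<^sub>\<infinity>y. ennreal (f y)) = (SUP F\<in>{F. finite F \<and> F \<subseteq> UNIV}. \<Sum>y\<in>F. ennreal (f y))"
    by (rule nonneg_infsum_complete) simp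
  then show ?thesis
    using assms by (simp add: SUP_le_iff sum_ennreal)
qed

lemma divide_ennreal_le_iff:
  assumes "0 < q" "0 \<le> c"
  shows "a / ennreal q \<le> ennreal c \<longleftrightarrow> a \<le> ennreal (c * q)"
proof (cases a)
  case (real r)
  then show ?thesis
    using assms by (simp add: divide_ennreal pos_divide_le_eq)
next
  case top
  then show ?thesis
    using assms by (simp add: ennreal_top_divide top_unique)
qed

lemma intrinsic_iff_finite_sums:
  assumes "weighted_graph b m"
  shows "intrinsic b m \<rho> \<longleftrightarrow> (\<forall>x F. finite F \<longrightarrow> (\<Sum>y\<in>F. b x y * (\<rho> x y)\<^sup>2) \<le> m x)"
proof -
  have "0 \<le> b x y" "0 \<le> m x" for x y
    using assms by (auto simp: weighted_graph_def less_imp_le)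
  then show ?thesis
    by (simp add: intrinsic_def infsum_ennreal_le_iff)
qed

lemma intrinsic_mono:
  assumes G: "weighted_graph b m" and \<rho>: "intrinsic b m \<rho>"
    and le: "\<And>x y. \<bar>\<sigma> x y\<bar> \<le> \<rho> x y"
  shows "intrinsic b m \<sigma>"
  unfolding intrinsic_iff_finite_sums[OF G]
proof (intro allI impI)
  fix x and F :: "'a set" assume F: "finite F"
  have b: "0 \<le> b x y" for y
    using G by (auto simp: weighted_graph_def)
  have "(\<Sum>y\<in>F. b x y * (\<sigma> x y)\<^sup>2) \<le> (\<Sum>y\<in>F. b x y * (\<rho> x y)\<^sup>2)"
    by (intro sum_mono mult_left_mono b) (simp add: abs_le_square_iff[symmetric] order_trans[OF le])
  also have "\<dots> \<le> m x"
    using \<rho> F by (simp add: intrinsic_iff_finite_sums[OF G])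
  finally show "(\<Sum>y\<in>F. b x y * (\<sigma> x y)\<^sup>2) \<le> m x" .
qed

text \<open>
  The square is convex in every summand; this is the step that lets an arbitrary
  intrinsic pseudo-metric be perturbed into one with finite balls.
\<close>

lemma intrinsic_convex:
  assumes G: "weighted_graph b m" and \<rho>: "intrinsic b m \<rho>" and \<sigma>: "intrinsic b m \<sigma>"
    and s: "0 \<le> s" "s \<le> 1"
  shows "intrinsic b m (\<lambda>x y. s * \<rho> x y + (1 - s) * \<sigma> x y)"
  unfolding intrinsic_iff_finite_sums[OF G]
proof (intro allI impI)
  fix x and F :: "'a set" assume F: "finite F"
  have b: "0 \<le> b x y" for y
    using G by (auto simp: weighted_graph_def)
  have square: "(s * u + (1 - s) * v)\<^sup>2 \<le> s * u\<^sup>2 + (1 - s) * v\<^sup>2" for u v :: real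
  proof -
    have "s * u\<^sup>2 + (1 - s) * v\<^sup>2 - (s * u + (1 - s) * v)\<^sup>2 = s * (1 - s) * (u - v)\<^sup>2"
      by (simp add: power2_eq_square algebra_simps)
    moreover have "0 \<le> s * (1 - s) * (u - v)\<^sup>2"
      using s by simp
    ultimately show ?thesis by linarith
  qed
  have "(\<Sum>y\<in>F. b x y * (s * \<rho> x y + (1 - s) * \<sigma> x y)\<^sup>2)
      \<le> (\<Sum>y\<in>F. b x y * (s * (\<rho> x y)\<^sup>2 + (1 - s) * (\<sigma> x y)\<^sup>2))"
    by (intro sum_mono mult_left_mono b square)
  also have "\<dots> = s * (\<Sum>y\<in>F. b x y * (\<rho> x y)\<^sup>2) + (1 - s) * (\<Sum>y\<in>F. b x y * (\<sigma> x y)\<^sup>2)"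
    by (simp add: sum_distrib_left distrib_left mult.left_commute flip: sum.distrib)
  also have "\<dots> \<le> s * m x + (1 - s) * m x"
    using \<rho> \<sigma> F s by (intro add_mono mult_left_mono) (simp_all add: intrinsic_iff_finite_sums[OF G])
  finally show "(\<Sum>y\<in>F. b x y * (s * \<rho> x y + (1 - s) * \<sigma> x y)\<^sup>2) \<le> m x"
    by (simp add: algebra_simps)
qed

lemma pseudo_metric_convex:
  assumes "pseudo_metric \<rho>" "pseudo_metric \<sigma>" and s: "0 \<le> s" "s \<le> 1"
  shows "pseudo_metric (\<lambda>x y. s * \<rho> x y + (1 - s) * \<sigma> x y)"
proof -
  have tri: "s * \<rho> x z + (1 - s) * \<sigma> x z
      \<le> (s * \<rho> x y + (1 - s) * \<sigma> x y) + (s * \<rho> y z + (1 - s) * \<sigma> y z)" for x y z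
  proof -
    have "s * \<rho> x z + (1 - s) * \<sigma> x z \<le> s * (\<rho> x y + \<rho> y z) + (1 - s) * (\<sigma> x y + \<sigma> y z)"
      using assms by (intro add_mono mult_left_mono) (auto simp: pseudo_metric_def)
    then show ?thesis by (simp add: algebra_simps)
  qed
  have "0 \<le> \<rho> x y" "0 \<le> \<sigma> x y" "\<rho> x x = 0" "\<sigma> x x = 0" "\<rho> x y = \<rho> y x" "\<sigma> x y = \<sigma> y x" for x y
    using assms(1,2) unfolding pseudo_metric_def by blast+
  then show ?thesis
    unfolding pseudo_metric_def using s by (intro conjI allI tri) simp_all
qed

section \<open>Davies' test functions\<close>

text \<open>
  A finitely supported function lies in the form domain by \<open>Cc_subset_form_domain\<close>, and after
  multiplication by \<open>2 m x\<close> the condition \<^term>\<open>Gamma b m \<psi> x \<le> 1\<close> is twice the intrinsic inequality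
  for \<open>|\<psi> x - \<psi> y| / \<surd>2\<close>.
\<close>

lemma davies_test_iff_intrinsic:
  assumes G: "weighted_graph b m"
  shows "\<psi> \<in> davies_test b m \<longleftrightarrow> \<psi> \<in> Cc \<and> intrinsic b m (\<lambda>x y. \<bar>\<psi> x - \<psi> y\<bar> / sqrt 2)"
proof -
  have b: "0 \<le> b x y" and m: "0 < m x" for x y
    using G by (auto simp: weighted_graph_def)
  have "Gamma b m \<psi> x \<le> 1
      \<longleftrightarrow> (\<forall>F. finite F \<longrightarrow> (\<Sum>y\<in>F. b x y * (\<bar>\<psi> x - \<psi> y\<bar> / sqrt 2)\<^sup>2) \<le> m x)" for x
  proof -
    have "Gamma b m \<psi> x \<le> 1 \<longleftrightarrow> (\<Sum>\<^sub>\<infinity>y. ennreal (b x y * (\<psi> x - \<psi> y)\<^sup>2)) \<le> ennreal (2 * m x)"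
      using divide_ennreal_le_iff[of "2 * m x" 1] m[of x] by (simp add: Gamma_def)
    also have "\<dots> \<longleftrightarrow> (\<forall>F. finite F \<longrightarrow> (\<Sum>y\<in>F. b x y * (\<psi> x - \<psi> y)\<^sup>2) \<le> 2 * m x)"
      using b m[of x] by (intro infsum_ennreal_le_iff) simp_all
    finally show ?thesis
      by (simp add: power_divide mult.commute flip: sum_divide_distrib)
  qed
  then show ?thesis
    using Cc_subset_form_domain[of b m]
    by (auto simp: davies_test_def SUP_le_iff intrinsic_iff_finite_sums[OF G])
qed

text \<open>
  The tent function centred at \<open>x\<close> with radius \<open>\<rho> x y\<close> vanishes at \<open>y\<close> and outside the ball of that
  radius, so finiteness of balls is what makes it a test function.
\<close>

lemma rho_E_ge_finite_balls:
  assumes G: "weighted_graph b m" and pm: "pseudo_metric \<rho>" and \<rho>: "intrinsic b m \<rho>"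
    and fin: "finite_balls \<rho>"
  shows "ennreal (sqrt 2 * \<rho> x y) \<le> rho_E b m x y"
proof -
  have nonneg: "0 \<le> \<rho> u v" and refl: "\<rho> u u = 0" and sym: "\<rho> u v = \<rho> v u"
    and tri: "\<rho> u w \<le> \<rho> u v + \<rho> v w" for u v w
    using pm by (auto simp: pseudo_metric_def)
  define \<psi> where "\<psi> z = sqrt 2 * max 0 (\<rho> x y - \<rho> x z)" for z
  have "{z. \<psi> z \<noteq> 0} \<subseteq> {z. \<rho> x z \<le> \<rho> x y}"
    by (auto simp: \<psi>_def max_def)
  moreover have "finite {z. \<rho> x z \<le> \<rho> x y}"
    using fin nonneg by (simp add: finite_balls_def)
  ultimately have "\<psi> \<in> Cc"
    unfolding Cc_def using finite_subset by blast
  moreover have "intrinsic b m (\<lambda>u v. \<bar>\<psi> u - \<psi> v\<bar> / sqrt 2)"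
  proof (rule intrinsic_mono[OF G \<rho>])
    fix u v
    have "\<psi> u - \<psi> v = sqrt 2 * (max 0 (\<rho> x y - \<rho> x u) - max 0 (\<rho> x y - \<rho> x v))"
      by (simp add: \<psi>_def right_diff_distrib)
    then have "\<bar>\<psi> u - \<psi> v\<bar> / sqrt 2 = \<bar>max 0 (\<rho> x y - \<rho> x u) - max 0 (\<rho> x y - \<rho> x v)\<bar>"
      by (simp add: abs_mult)
    also have "\<dots> \<le> \<rho> u v"
      using tri[of x u v] tri[of x v u] sym[of u v] nonneg[of u v] by (auto simp: max_def)
    finally show "\<bar>\<bar>\<psi> u - \<psi> v\<bar> / sqrt 2\<bar> \<le> \<rho> u v"
      by simp
  qed
  ultimately have "\<psi> \<in> davies_test b m"
    by (simp add: davies_test_iff_intrinsic[OF G])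
  then have "ennreal \<bar>\<psi> x - \<psi> y\<bar> \<le> rho_E b m x y"
    unfolding rho_E_def by (rule SUP_upper)
  moreover have "\<bar>\<psi> x - \<psi> y\<bar> = sqrt 2 * \<rho> x y"
    using nonneg[of x y] by (simp add: \<psi>_def refl)
  ultimately show ?thesis by simp
qed

section \<open>The combinatorial distance\<close>

definition hop_dist :: "('a \<Rightarrow> 'a \<Rightarrow> real) \<Rightarrow> 'a \<Rightarrow> 'a \<Rightarrow> nat" where
  "hop_dist b x y = (LEAST n. (adj b ^^ n) x y)"

lemma hop_dist_le: "(adj b ^^ n) x y \<Longrightarrow> hop_dist b x y \<le> n"
  unfolding hop_dist_def by (rule Least_le)

lemma hop_dist_walk:
  assumes "connected_graph b"
  shows "(adj b ^^ hop_dist b x y) x y"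
proof -
  have "\<exists>n. (adj b ^^ n) x y"
    using assms by (intro rtranclp_imp_relpowp) (simp add: connected_graph_def)
  then show ?thesis
    unfolding hop_dist_def by (rule LeastI_ex)
qed

lemma relpowp_symp:
  assumes "symp R" "(R ^^ n) x y"
  shows "(R ^^ n) y x"
  using assms(2)
proof (induction n arbitrary: y)
  case (Suc n)
  then obtain z where "(R ^^ n) x z" "R z y"
    by (auto elim: relpowp_Suc_E)
  with Suc.IH show ?case
    using sympD[OF assms(1)] by (blast intro: relpowp_Suc_I2)
qed simp

lemma symp_adj: "weighted_graph b m \<Longrightarrow> symp (adj b)"
  by (auto simp: symp_def adj_def weighted_graph_def)

lemma pseudo_metric_hop_dist:
  assumes G: "weighted_graph b m" and conn: "connected_graph b"
  shows "pseudo_metric (\<lambda>x y. real (hop_dist b x y))"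
proof -
  have refl: "hop_dist b x x = 0" for x
    using hop_dist_le[of 0 b x x] by simp
  have le: "hop_dist b y x \<le> hop_dist b x y" for x y
    by (rule hop_dist_le[OF relpowp_symp[OF symp_adj[OF G] hop_dist_walk[OF conn]]])
  have tri: "hop_dist b x z \<le> hop_dist b x y + hop_dist b y z" for x y z
    by (rule hop_dist_le[OF relpowp_trans[OF hop_dist_walk[OF conn] hop_dist_walk[OF conn]]])
  show ?thesis
    unfolding pseudo_metric_def of_nat_add[symmetric] of_nat_le_iff of_nat_eq_iff
    by (intro conjI allI tri antisym[OF le le]) (simp_all add: refl)
qed

lemma finite_relpowp_successors:
  fixes R :: "'a \<Rightarrow> 'a \<Rightarrow> bool"
  assumes "\<And>x. finite {y. R x y}"
  shows "finite {y. (R ^^ n) x y}"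
proof (induction n)
  case (Suc n)
  have "{y. (R ^^ Suc n) x y} = (\<Union>z\<in>{z. (R ^^ n) x z}. {y. R z y})"
    by (auto simp: relcompp_apply)
  with Suc assms show ?case by simp
qed simp

text \<open>
  A ball consists of the end points of walks of bounded length, and local finiteness leaves only
  finitely many of these. Connectedness makes \<^const>\<open>hop_dist\<close> the length of an actual walk.
\<close>

lemma finite_balls_hop_dist:
  assumes G: "weighted_graph b m" and lf: "locally_finite_graph b" and conn: "connected_graph b"
  shows "finite_balls (\<lambda>x y. real (hop_dist b x y))"
  unfolding finite_balls_def
proof (intro allI impI)
  fix x and R :: real assume "0 \<le> R"
  have "{y. adj b u y} = {y. adj b y u}" for u
    using symp_adj[OF G] by (auto dest: sympD)
  then have "finite {y. adj b u y}" for u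
    using lf by (simp add: locally_finite_graph_def)
  then have "finite (\<Union>n\<le>nat \<lfloor>R\<rfloor>. {y. (adj b ^^ n) x y})"
    by (simp add: finite_relpowp_successors)
  moreover have "y \<in> (\<Union>n\<le>nat \<lfloor>R\<rfloor>. {y. (adj b ^^ n) x y})" if "real (hop_dist b x y) \<le> R" for y
    using hop_dist_walk[OF conn, of x y] that by (auto simp: le_nat_floor)
  ultimately show "finite {y. real (hop_dist b x y) \<le> R}"
    by (elim finite_subset[rotated]) blast
qed

text \<open>
  The intrinsic inequality only sees edges, along which the combinatorial distance is at most \<open>1\<close>; the
  sum over the neighbours is therefore controlled by \<^term>\<open>deg b x\<close> divided by \<open>D\<close>.
\<close>

lemma intrinsic_hop_dist:
  assumes G: "weighted_graph b m" and D: "0 < D" and Deg: "\<And>x. Deg b m x \<le> ennreal D"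
  shows "intrinsic b m (\<lambda>x y. real (hop_dist b x y) / sqrt D)"
  unfolding intrinsic_iff_finite_sums[OF G]
proof (intro allI impI)
  fix x and F :: "'a set" assume F: "finite F"
  have b: "0 \<le> b x y" and m: "0 < m x" for y
    using G by (auto simp: weighted_graph_def)
  have edge: "b x y * (real (hop_dist b x y) / sqrt D)\<^sup>2 \<le> b x y / D" for y
  proof (cases "b x y = 0")
    case False
    then have "(adj b ^^ 1) x y"
      using b[of y] unfolding relpowp_1 by (simp add: adj_def)
    then have "hop_dist b x y \<le> 1"
      by (rule hop_dist_le)
    then have "(real (hop_dist b x y))\<^sup>2 \<le> 1"
      by (simp add: power_le_one)
    then show ?thesis
      using mult_left_mono[OF _ b[of y], of _ 1] D by (simp add: power_divide divide_right_mono)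
  qed simp
  have "deg b x \<le> ennreal (D * m x)"
    using Deg[of x] D m by (simp add: Deg_def divide_ennreal_le_iff)
  then have "(\<Sum>y\<in>F. b x y) \<le> D * m x"
    using F b D m by (simp add: deg_def infsum_ennreal_le_iff)
  then have "(\<Sum>y\<in>F. b x y / D) \<le> m x"
    using D by (simp add: pos_divide_le_eq mult.commute flip: sum_divide_distrib)
  then show "(\<Sum>y\<in>F. b x y * (real (hop_dist b x y) / sqrt D)\<^sup>2) \<le> m x"
    using sum_mono[OF edge] by (rule order_trans[rotated])
qed

section \<open>Comparison of the metrics\<close>

text \<open>
  The combination \<open>s \<rho> + (1 - s) \<sigma>\<close> with the rescaled combinatorial distance \<open>\<sigma>\<close> has finite balls for
  every \<open>s < 1\<close> and dominates \<open>s \<rho>\<close>; the claim is the limit \<open>s \<rightarrow> 1\<close>.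
\<close>

lemma rho_E_ge_bounded_Deg:
  assumes G: "weighted_graph b m" and lf: "locally_finite_graph b" and conn: "connected_graph b"
    and bdd: "(SUP x. Deg b m x) < \<infinity>" and pm: "pseudo_metric \<rho>" and \<rho>: "intrinsic b m \<rho>"
  shows "ennreal (sqrt 2 * \<rho> x y) \<le> rho_E b m x y"
proof -
  obtain D where D: "0 < D" and Deg: "\<And>x. Deg b m x \<le> ennreal D"
  proof -
    obtain r where r: "0 \<le> r" "(SUP x. Deg b m x) = ennreal r"
      using bdd by (cases "SUP x. Deg b m x") auto
    have "Deg b m x \<le> ennreal (r + 1)" for x
    proof -
      have "Deg b m x \<le> ennreal r"
        using r by (metis SUP_upper UNIV_I)
      also have "\<dots> \<le> ennreal (r + 1)"
        using r by (simp add: ennreal_leI)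
      finally show ?thesis .
    qed
    \<comment> \<open>The bound is enlarged by \<open>1\<close> so that dividing by its square root is harmless even if \<open>r = 0\<close>.\<close>
    with r that[of "r + 1"] show thesis by simp
  qed
  define \<sigma> where "\<sigma> u v = real (hop_dist b u v) / sqrt D" for u v
  have \<sigma>_pm: "pseudo_metric \<sigma>"
    using pseudo_metric_hop_dist[OF G conn] D
    by (simp add: pseudo_metric_def \<sigma>_def divide_right_mono flip: add_divide_distrib)
  have \<sigma>_intr: "intrinsic b m \<sigma>"
    unfolding \<sigma>_def by (rule intrinsic_hop_dist[OF G D Deg])
  have nonneg: "0 \<le> \<rho> u v" "0 \<le> \<sigma> u v" for u v
    using pm \<sigma>_pm by (auto simp: pseudo_metric_def)
  have scaled: "ennreal (s * (sqrt 2 * \<rho> x y)) \<le> rho_E b m x y" if s: "0 < s" "s < 1" for s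
  proof -
    define \<tau> where "\<tau> u v = s * \<rho> u v + (1 - s) * \<sigma> u v" for u v
    have "finite {v. \<tau> u v \<le> R}" if "0 \<le> R" for u R
    proof (rule finite_subset)
      show "{v. \<tau> u v \<le> R} \<subseteq> {v. real (hop_dist b u v) \<le> R * sqrt D / (1 - s)}"
      proof clarify
        fix v assume "\<tau> u v \<le> R"
        then have "(1 - s) * \<sigma> u v \<le> R"
          using mult_nonneg_nonneg[of s "\<rho> u v"] s nonneg(1)[of u v] unfolding \<tau>_def by linarith
        then show "real (hop_dist b u v) \<le> R * sqrt D / (1 - s)"
          using s D by (simp add: \<sigma>_def field_simps)
      qed
      show "finite {v. real (hop_dist b u v) \<le> R * sqrt D / (1 - s)}"
        using finite_balls_hop_dist[OF G lf conn] that s D by (simp add: finite_balls_def)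
    qed
    then have "finite_balls \<tau>"
      by (simp add: finite_balls_def)
    moreover have "pseudo_metric \<tau>" "intrinsic b m \<tau>"
      unfolding \<tau>_def using s
      by (auto intro: pseudo_metric_convex[OF pm \<sigma>_pm] intrinsic_convex[OF G \<rho> \<sigma>_intr])
    ultimately have "ennreal (sqrt 2 * \<tau> x y) \<le> rho_E b m x y"
      using G by (blast intro: rho_E_ge_finite_balls)
    moreover have "s * (sqrt 2 * \<rho> x y) \<le> sqrt 2 * \<tau> x y"
      using s nonneg(2)[of x y] by (simp add: \<tau>_def algebra_simps mult_left_le_one_le)
    ultimately show ?thesis
      using ennreal_leI order_trans by blast
  qed
  show ?thesis
  proof (cases "rho_E b m x y")
    case (real e)
    have "s * (sqrt 2 * \<rho> x y) \<le> e" if "0 < s" "s < 1" for s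
      using scaled[OF that] unfolding real(2) ennreal_le_iff[OF real(1)] .
    then have "sqrt 2 * \<rho> x y \<le> e"
      by (rule field_le_mult_one_interval)
    with real show ?thesis by (simp add: ennreal_leI)
  qed simp
qed

lemma rho_E_le_regular:
  assumes G: "weighted_graph b m" and reg: "regular_graph (sqrt 2 * S) b m"
  shows "rho_E b m x y \<le> ennreal (sqrt 2) * rho S b m x y"
  unfolding rho_E_def
proof (rule SUP_least)
  fix \<psi> assume \<psi>: "\<psi> \<in> davies_test b m"
  define \<rho> where "\<rho> u v = \<bar>\<psi> u - \<psi> v\<bar> / sqrt 2" for u v
  have "pseudo_metric \<rho>"
    unfolding pseudo_metric_def \<rho>_def add_divide_distrib[symmetric]
    by (intro conjI allI divide_right_mono) (simp_all add: abs_minus_commute)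
  moreover have "intrinsic b m \<rho>"
    using \<psi> by (simp add: davies_test_iff_intrinsic[OF G] \<rho>_def[abs_def])
  moreover have "\<rho> u v \<le> S" if "0 < b u v" for u v
    using reg \<psi> that by (simp add: regular_graph_def \<rho>_def pos_divide_le_eq mult.commute)
  then have "jump_size b \<rho> \<le> ennreal S"
    by (auto simp: jump_size_def SUP_le_iff intro: ennreal_leI)
  ultimately have "ennreal (\<rho> x y) \<le> rho S b m x y"
    unfolding rho_def by (intro SUP_upper) simp
  then have "ennreal (sqrt 2) * ennreal (\<rho> x y) \<le> ennreal (sqrt 2) * rho S b m x y"
    by (rule mult_left_mono) simp
  moreover have "ennreal (sqrt 2) * ennreal (\<rho> x y) = ennreal \<bar>\<psi> x - \<psi> y\<bar>"
    by (simp add: \<rho>_def flip: ennreal_mult)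
  ultimately show "ennreal \<bar>\<psi> x - \<psi> y\<bar> \<le> ennreal (sqrt 2) * rho S b m x y"
    by simp
qed

theorem lemma13:
  fixes b :: "'a::countable \<Rightarrow> 'a \<Rightarrow> real" and m :: "'a \<Rightarrow> real" and S :: real
  assumes "0 < S"
    and "weighted_graph b m"
    and "locally_finite_graph b"
    and "connected_graph b"
  shows "(\<forall>x y. ennreal (sqrt 2) * rho' S b m x y \<le> rho_E b m x y) \<and>
    ((SUP x. Deg b m x) < \<infinity> \<longrightarrow>
      (\<forall>x y. ennreal (sqrt 2) * rho S b m x y \<le> rho_E b m x y)) \<and>
    (regular_graph (sqrt 2 * S) b m \<longrightarrow>
      (\<forall>x y. rho_E b m x y \<le> ennreal (sqrt 2) * rho S b m x y))"
proof (intro conjI impI allI)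
  have scale: "ennreal (sqrt 2) * ennreal (\<rho> x y) = ennreal (sqrt 2 * \<rho> x y)"
    if "pseudo_metric \<rho>" for \<rho> :: "'a \<Rightarrow> 'a \<Rightarrow> real" and x y
    using that by (simp add: pseudo_metric_def ennreal_mult)
  fix x y
  show "ennreal (sqrt 2) * rho' S b m x y \<le> rho_E b m x y"
    unfolding rho'_def SUP_mult_left_ennreal
    by (rule SUP_least) (auto simp: scale intro: rho_E_ge_finite_balls[OF assms(2)])
  show "ennreal (sqrt 2) * rho S b m x y \<le> rho_E b m x y" if "(SUP x. Deg b m x) < \<infinity>"
    unfolding rho_def SUP_mult_left_ennreal
    by (rule SUP_least) (auto simp: scale intro: rho_E_ge_bounded_Deg[OF assms(2-4) that])
  show "rho_E b m x y \<le> ennreal (sqrt 2) * rho S b m x y" if "regular_graph (sqrt 2 * S) b m"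
    by (rule rho_E_le_regular[OF assms(2) that])
qed

end
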